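(* Let $\mathcal{X}$ be a complete separable metric space equipped with its Borel sigma-field $\mathcal{S}$, and let $\mathcal{C} \subseteq \mathcal{S}$ be any countable family of sets. If $\dim(\mathcal{C}) < \infty$, then for every stationary ergodic process $\mathbf{X} = X_1, X_2, \ldots$ taking values in $(\mathcal{X}, \mathcal{S})$, $$\Gamma_m(\mathcal{C} : \mathbf{X}) = \sup_{C \in \mathcal{C}} \left| \frac{1}{m} \sum_{i=1}^m I(X_i \in C) - \mathbb{P}(X \in C) \right| \to 0 \quad \text{with probability one}$$ as $m$ tends to infinity.
   Context: $I(\cdot)$ denotes the indicator of an event. $X$ denotes a random variable with the same distribution as $X_1$ (independent of $\mathbf{X}$), so $\mathbb{P}(X \in C) = \mathbb{P}(X_1 \in C)$. A stationary process is ergodic if its invariant sigma-field is trivial. VC dimension: for a collection $\mathcal{C}$ of subsets of $\mathcal{X}$ and a finite set $D \subseteq \mathcal{X}$, let $S(D : \mathcal{C}) = |\{ C \cap D : C \in \mathcal{C} \}|$. The VC dimension $\dim(\mathcal{C})$ is the largest integer $k \geq 1$ such that $S(D : \mathcal{C}) = 2^k$ for some $k$-element subset $D$ of $\mathcal{X}$ (taken to be $0$ if no such $k$ exists); if for every $k \geq 1$ there is a $k$-element set $D$ with $S(D : \mathcal{C}) = 2^k$, then $\dim(\mathcal{C}) = +\infty$. *)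

theory Defs
  imports "HOL-Probability.Probability"
begin

text \<open>Processes are indexed from \<open>0\<close>: the variables \<open>X\<^sub>1, X\<^sub>2, \<dots>\<close> are \<open>X 0, X 1, \<dots>\<close>.\<close>

definition path :: "(nat \<Rightarrow> 'w \<Rightarrow> 'a) \<Rightarrow> 'w \<Rightarrow> nat \<Rightarrow> 'a" where
  "path X \<omega> = (\<lambda>i. X i \<omega>)"

definition shift :: "(nat \<Rightarrow> 'a) \<Rightarrow> nat \<Rightarrow> 'a" where
  "shift x = (\<lambda>i. x (Suc i))"

definition stationary_process :: "'w measure \<Rightarrow> 'a measure \<Rightarrow> (nat \<Rightarrow> 'w \<Rightarrow> 'a) \<Rightarrow> bool" where
  "stationary_process M S X \<longleftrightarrow>
     (\<forall>i. X i \<in> measurable M S) \<and>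
     distr M (Pi\<^sub>M UNIV (\<lambda>_. S)) (\<lambda>\<omega>. shift (path X \<omega>)) = distr M (Pi\<^sub>M UNIV (\<lambda>_. S)) (path X)"

definition invariant_events :: "'w measure \<Rightarrow> 'a measure \<Rightarrow> (nat \<Rightarrow> 'w \<Rightarrow> 'a) \<Rightarrow> 'w set set" where
  "invariant_events M S X =
     {path X -` B \<inter> space M | B.
        B \<in> sets (Pi\<^sub>M UNIV (\<lambda>_. S)) \<and> shift -` B \<inter> space (Pi\<^sub>M UNIV (\<lambda>_. S)) = B}"

definition stationary_ergodic_process :: "'w measure \<Rightarrow> 'a measure \<Rightarrow> (nat \<Rightarrow> 'w \<Rightarrow> 'a) \<Rightarrow> bool" where
  "stationary_ergodic_process M S X \<longleftrightarrow>
     stationary_process M S X \<and>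
     (\<forall>A \<in> invariant_events M S X. measure M A = 0 \<or> measure M A = 1)"

definition shatter_coeff :: "'a set \<Rightarrow> 'a set set \<Rightarrow> nat" where
  "shatter_coeff D \<C> = card {C \<inter> D | C. C \<in> \<C>}"

definition shatters_some :: "'a set set \<Rightarrow> nat \<Rightarrow> bool" where
  "shatters_some \<C> k \<longleftrightarrow> (\<exists>D. finite D \<and> card D = k \<and> shatter_coeff D \<C> = 2 ^ k)"

text \<open>
  Subsets of shattered sets are shattered. So if \<open>shatters_some \<C> k\<close> fails for one \<open>k\<close>, it fails
  for all larger ones, and the \<open>GREATEST\<close> below is a genuine maximum.
\<close>

definition vc_dim :: "'a set set \<Rightarrow> enat" where
  "vc_dim \<C> =
     (if \<forall>k\<ge>1. shatters_some \<C> k then \<infinity>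
      else if \<exists>k\<ge>1. shatters_some \<C> k then enat (GREATEST k. k \<ge> 1 \<and> shatters_some \<C> k)
      else 0)"

text \<open>
  The supremum is taken in \<open>[0, \<infinity>]\<close>, where it is \<open>0\<close> for the empty family; in type \<open>real\<close> the
  supremum of the empty set is unspecified. For \<open>m = 0\<close> the average is \<open>0\<close>.
\<close>

definition uniform_deviation ::
    "'w measure \<Rightarrow> (nat \<Rightarrow> 'w \<Rightarrow> 'a) \<Rightarrow> 'a set set \<Rightarrow> nat \<Rightarrow> 'w \<Rightarrow> ennreal" where
  "uniform_deviation M X \<C> m \<omega> =
     (SUP C\<in>\<C>. ennreal \<bar>(1 / real m) * (\<Sum>i<m. indicator C (X i \<omega>))
                        - measure M {\<omega> \<in> space M. X 0 \<omega> \<in> C}\<bar>)"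

end

theory Submission
  imports Defs
begin

text \<open>
  A countable class of finite VC dimension has finitely many brackets of size \<open>\<epsilon>\<close> for every
  probability measure. Otherwise call a subclass bad if it is not a finite union of classes \<open>D\<close> with
  \<open>\<mu> (\<Union>D - \<Inter>D) < \<epsilon>\<close>. A finite union of subclasses that are not bad is not bad. This yields a
  region \<open>W\<close> of positive measure such that any finitely many subsets of \<open>W\<close> of positive measure are
  split simultaneously by a single member of the class. Splitting \<open>W\<close> repeatedly produces
  arbitrarily many sets in general position, and hence arbitrarily large shattered sets. Given the
  brackets, uniform convergence follows from Birkhoff's theorem for their finitely many end sets.
\<close>

subsection \<open>The ergodic theorem\<close>

lemma measure_preserving_integral:
  fixes f :: "'a \<Rightarrow> real"
  assumes T: "T \<in> measurable M M" and pres: "distr M M T = M" and f: "integrable M f"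
  shows "integrable M (\<lambda>x. f (T x))" and "(\<integral>x. f (T x) \<partial>M) = (\<integral>x. f x \<partial>M)"
proof -
  have fm: "f \<in> borel_measurable M"
    using f by auto
  show "integrable M (\<lambda>x. f (T x))"
    using integrable_distr_eq[OF T fm] f pres by simp
  show "(\<integral>x. f (T x) \<partial>M) = (\<integral>x. f x \<partial>M)"
    using integral_distr[OF T fm] pres by simp
qed

section \<open>Birkhoff sums and the maximal ergodic inequality\<close>

definition birkhoff_sum :: "('a \<Rightarrow> 'a) \<Rightarrow> ('a \<Rightarrow> real) \<Rightarrow> nat \<Rightarrow> 'a \<Rightarrow> real" where
  "birkhoff_sum T g n x = (\<Sum>i<n. g ((T ^^ i) x))"

lemma birkhoff_sum_0 [simp]: "birkhoff_sum T g 0 x = 0"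
  by (simp add: birkhoff_sum_def)

lemma birkhoff_sum_Suc: "birkhoff_sum T g (Suc n) x = g x + birkhoff_sum T g n (T x)"
  unfolding birkhoff_sum_def
  by (simp add: sum.lessThan_Suc_shift funpow_swap1 del: sum.lessThan_Suc)

lemma borel_measurable_birkhoff_sum:
  assumes [measurable]: "T \<in> measurable M M" "g \<in> borel_measurable M"
  shows "birkhoff_sum T g n \<in> borel_measurable M"
proof (induction n)
  case 0
  then show ?case by (simp add: birkhoff_sum_def[abs_def])
next
  case (Suc n)
  note [measurable] = Suc
  show ?case
    unfolding birkhoff_sum_Suc[abs_def] by measurable
qed

text \<open>\<open>birkhoff_max T g n\<close> is the maximum of the Birkhoff sums of lengths \<open>0, \<dots>, n\<close>.\<close>

fun birkhoff_max :: "('a \<Rightarrow> 'a) \<Rightarrow> ('a \<Rightarrow> real) \<Rightarrow> nat \<Rightarrow> 'a \<Rightarrow> real" where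
  "birkhoff_max T g 0 x = 0"
| "birkhoff_max T g (Suc n) x = max 0 (g x + birkhoff_max T g n (T x))"

lemma birkhoff_max_nonneg: "birkhoff_max T g n x \<ge> 0"
  by (cases n) auto

lemma birkhoff_sum_le_max: "birkhoff_sum T g n x \<le> birkhoff_max T g n x"
proof (induction n arbitrary: x)
  case (Suc n)
  from Suc[of "T x"] show ?case by (simp add: birkhoff_sum_Suc)
qed simp

lemma birkhoff_max_mono: "birkhoff_max T g n x \<le> birkhoff_max T g (Suc n) x"
proof (induction n arbitrary: x)
  case (Suc n)
  from Suc[of "T x"] show ?case by (auto simp: max_def)
qed simp

text \<open>A positive maximum is given by the second argument of \<open>max\<close> in the
  recursion; monotonicity in the length then restores \<open>n\<close> on the right. Having the same
  \<open>n\<close> on both sides lets the two integrals cancel later.\<close>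

lemma birkhoff_max_cocycle:
  assumes "birkhoff_max T g n x > 0"
  shows "birkhoff_max T g n x \<le> g x + birkhoff_max T g n (T x)"
proof (cases n)
  case (Suc k)
  then show ?thesis
    using assms birkhoff_max_mono[of T g k "T x"] by (auto simp: max_def split: if_splits)
qed (use assms in simp)

lemma integrable_birkhoff_max:
  assumes "T \<in> measurable M M" "distr M M T = M" "integrable M g"
  shows "integrable M (birkhoff_max T g n)"
proof (induction n)
  case 0
  then show ?case by simp
next
  case (Suc n)
  have "integrable M (\<lambda>x. max 0 (g x + birkhoff_max T g n (T x)))"
    using measure_preserving_integral(1)[OF assms(1,2) Suc] assms(3)
    by (intro integrable_max Bochner_Integration.integrable_add) auto
  then show ?case
    by simp
qed

text \<open>Garsia's argument: the maximum minus its composite with \<open>T\<close> has integral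
  zero by invariance. It is at most \<open>g\<close> where the maximum is positive, and at most 0
  elsewhere because the composite is nonnegative.\<close>

lemma maximal_ergodic:
  assumes T: "T \<in> measurable M M" "distr M M T = M" and g: "integrable M g"
  shows "(\<integral>x. indicator {x\<in>space M. birkhoff_max T g n x > 0} x * g x \<partial>M) \<ge> 0"
proof -
  let ?B = "birkhoff_max T g n"
  have B: "integrable M ?B"
    using integrable_birkhoff_max[OF T g] .
  note BT = measure_preserving_integral[OF T B]
  have [measurable]: "?B \<in> borel_measurable M" "g \<in> borel_measurable M"
    using B g by auto
  have "0 = (\<integral>x. ?B x - ?B (T x) \<partial>M)"
    using B BT by simp
  also have "\<dots> \<le> (\<integral>x. indicator {x\<in>space M. ?B x > 0} x * g x \<partial>M)"
  proof (rule integral_mono)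
    show "integrable M (\<lambda>x. ?B x - ?B (T x))"
      using B BT by simp
    show "integrable M (\<lambda>x. indicator {x\<in>space M. ?B x > 0} x * g x)"
      by (rule Bochner_Integration.integrable_bound[OF g]) (auto simp: indicator_def)
    fix x assume "x \<in> space M"
    then show "?B x - ?B (T x) \<le> indicator {x\<in>space M. ?B x > 0} x * g x"
      using birkhoff_max_cocycle[of T g n x] birkhoff_max_nonneg[of T g n x]
        birkhoff_max_nonneg[of T g n "T x"]
      by (cases "?B x > 0") (auto simp: indicator_def)
  qed
  finally show ?thesis .
qed

text \<open>The sets where the maximum is positive increase with \<open>n\<close> and exhaust almost
  all of the space, so dominated convergence removes the indicator from the maximal
  inequality.\<close>

lemma integral_nonneg_of_birkhoff_sum_pos:
  assumes T: "T \<in> measurable M M" "distr M M T = M" and g: "integrable M g"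
    and pos: "AE x in M. \<exists>n. birkhoff_sum T g n x > 0"
  shows "(\<integral>x. g x \<partial>M) \<ge> 0"
proof -
  let ?f = "\<lambda>n x. indicator {x\<in>space M. birkhoff_max T g n x > 0} x * g x"
  have [measurable]: "birkhoff_max T g n \<in> borel_measurable M" "g \<in> borel_measurable M" for n
    using integrable_birkhoff_max[OF T g] g by auto
  have "(\<lambda>n. \<integral>x. ?f n x \<partial>M) \<longlonglongrightarrow> (\<integral>x. g x \<partial>M)"
  proof (rule integral_dominated_convergence[where w="\<lambda>x. \<bar>g x\<bar>"])
    show "AE x in M. (\<lambda>n. ?f n x) \<longlonglongrightarrow> g x"
      using pos
      AE_space
    proof eventually_elim
      case (elim x)
      then obtain n where "birkhoff_sum T g n x > 0" by auto
      then have n: "birkhoff_max T g n x > 0"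
        using birkhoff_sum_le_max[of T g n x] by linarith
      have "?f m x = g x" if "m \<ge> n" for m
      proof -
        have "incseq (\<lambda>n. birkhoff_max T g n x)"
          by (rule incseq_SucI) (rule birkhoff_max_mono)
        then have "birkhoff_max T g n x \<le> birkhoff_max T g m x"
          using that by (rule incseqD)
        with n elim show ?thesis by simp
      qed
      then show ?case
        by (intro tendsto_eventually) (auto simp: eventually_sequentially)
    qed
  qed (use g in \<open>auto simp: indicator_def\<close>)
  then show ?thesis
    by (rule LIMSEQ_le_const) (use maximal_ergodic[OF T g] in auto)
qed

text \<open>Unlike an event defined by averages, unboundedness of the sums is invariant without any limit argument.\<close>

lemma AE_birkhoff_sum_bounded_above:
  assumes "prob_space M" and T: "T \<in> measurable M M" "distr M M T = M"
    and ergodic: "\<forall>A\<in>sets M. T -` A \<inter> space M = A \<longrightarrow> measure M A = 0 \<or> measure M A = 1"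
    and g: "integrable M g" and neg: "(\<integral>x. g x \<partial>M) < 0"
  shows "AE x in M. \<exists>K. \<forall>n. birkhoff_sum T g n x \<le> K"
proof -
  interpret prob_space M by fact
  have gm: "g \<in> borel_measurable M" using g by auto
  note [measurable] = T(1) borel_measurable_birkhoff_sum[OF T(1) gm]
  define A where "A = {x\<in>space M. \<forall>K::nat. \<exists>n. birkhoff_sum T g n x > real K}"
  have A[measurable]: "A \<in> sets M"
    unfolding A_def by measurable
  have iff: "x \<in> A \<longleftrightarrow> x \<in> space M \<and> \<not> (\<exists>K. \<forall>n. birkhoff_sum T g n x \<le> K)" for x
  proof -
    have "(\<exists>K::nat. \<forall>n. birkhoff_sum T g n x \<le> real K) \<longleftrightarrow> (\<exists>K. \<forall>n. birkhoff_sum T g n x \<le> K)"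
      by (meson order_trans real_arch_simple)
    moreover have "x \<in> A \<longleftrightarrow> x \<in> space M \<and> \<not> (\<exists>K::nat. \<forall>n. birkhoff_sum T g n x \<le> real K)"
      by (simp add: A_def not_le)
    ultimately show ?thesis
      by simp
  qed
  have "T x \<in> A \<longleftrightarrow> x \<in> A" if x: "x \<in> space M" for x
  proof -
    have Tx: "T x \<in> space M"
      using measurable_space[OF T(1) x] .
    have "(\<exists>K. \<forall>n. birkhoff_sum T g n (T x) \<le> K) \<longleftrightarrow> (\<exists>K. \<forall>n. birkhoff_sum T g n x \<le> K)"
      (is "?L \<longleftrightarrow> ?R")
    proof
      assume ?L
      then obtain K where K: "\<And>n. birkhoff_sum T g n (T x) \<le> K" by auto
      \<comment> \<open>The 0 in the maximum covers the empty sum, which is not of the form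
        \<open>g x\<close> plus a sum along \<open>T x\<close>.\<close>
      have "birkhoff_sum T g n x \<le> max 0 (g x + K)" for n
      proof (cases n)
        case (Suc k)
        then show ?thesis using K[of k] by (simp add: birkhoff_sum_Suc)
      qed simp
      then show ?R by blast
    next
      assume ?R
      then obtain K where K: "\<And>n. birkhoff_sum T g n x \<le> K" by auto
      have "birkhoff_sum T g n (T x) \<le> K - g x" for n
        using K[of "Suc n"] by (simp add: birkhoff_sum_Suc)
      then show ?L by blast
    qed
    then show ?thesis
      by (simp only: iff x Tx simp_thms)
  qed
  then have "T -` A \<inter> space M = A"
    using sets.sets_into_space[OF A] by auto
  from ergodic A this have nz: "measure M A = 0 \<or> measure M A = 1"
    by blast
  then have "measure M A = 0"
  proof
    \<comment> \<open>Sums unbounded above almost everywhere would in particular be positive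
      somewhere (take \<open>K = 0\<close>), forcing a nonnegative integral.\<close>
    assume "measure M A = 1"
    then have "AE x in M. x \<in> A"
      using A prob_eq_1 by blast
    then have "AE x in M. \<exists>n. birkhoff_sum T g n x > 0"
      by eventually_elim (simp add: A_def, metis of_nat_0)
    from integral_nonneg_of_birkhoff_sum_pos[OF T g this] neg show ?thesis
      by simp
  qed
  then have "AE x in M. x \<notin> A"
    using A prob_eq_0 by blast
  then show ?thesis
    using iff by (auto elim!: AE_mp)
qed

text \<open>Subtracting slightly more than the mean makes the integral negative, so the sums stay
  below some \<open>K\<close>. The slack \<open>1 / Suc k\<close> is spent twice: once in this
  subtraction and once to absorb \<open>K / n\<close>.\<close>

lemma AE_birkhoff_average_limsup:
  assumes "prob_space M" and T: "T \<in> measurable M M" "distr M M T = M"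
    and ergodic: "\<forall>A\<in>sets M. T -` A \<inter> space M = A \<longrightarrow> measure M A = 0 \<or> measure M A = 1"
    and f: "integrable M f"
  shows "AE x in M. \<forall>k. \<forall>\<^sub>F n in sequentially.
           birkhoff_sum T f n x / n \<le> (\<integral>x. f x \<partial>M) + 2 / Suc k"
proof (rule AE_all_countable[THEN iffD2, rule_format])
  interpret prob_space M by fact
  fix k
  let ?q = "(\<integral>x. f x \<partial>M) + 1 / Suc k"
  let ?g = "\<lambda>x. f x - ?q"
  have sum: "birkhoff_sum T ?g n x = birkhoff_sum T f n x - n * ?q" for n x
    by (simp add: birkhoff_sum_def sum_subtractf)
  have "AE x in M. \<exists>K. \<forall>n. birkhoff_sum T ?g n x \<le> K"
    by (rule AE_birkhoff_sum_bounded_above[OF assms(1) T ergodic]) (use f in \<open>auto simp: prob_space\<close>)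
  then show "AE x in M. \<forall>\<^sub>F n in sequentially.
               birkhoff_sum T f n x / n \<le> (\<integral>x. f x \<partial>M) + 2 / Suc k"
  proof eventually_elim
    case (elim x)
    then obtain K where K: "\<And>n. birkhoff_sum T f n x \<le> n * ?q + K"
      unfolding sum by (auto simp: algebra_simps)
    have "(\<lambda>n. K / real n) \<longlonglongrightarrow> 0"
      by (rule lim_const_over_n)
    then have "\<forall>\<^sub>F n in sequentially. K / real n < 1 / Suc k"
      by (rule order_tendstoD) simp
    then show ?case
      using eventually_gt_at_top[of 0]
    proof eventually_elim
      case (elim n)
      have "birkhoff_sum T f n x / n \<le> (n * ?q + K) / n"
        using K by (intro divide_right_mono) auto
      also have "\<dots> = ?q + K / n"
        using elim by (simp add: field_simps)
      also have "\<dots> \<le> ?q + 1 / Suc k"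
        using elim by simp
      finally show ?case by simp
    qed
  qed
qed

text \<open>The upper bound for \<open>- f\<close> is the lower bound for \<open>f\<close>.\<close>

theorem birkhoff_ergodic:
  assumes "prob_space M" and T: "T \<in> measurable M M" "distr M M T = M"
    and ergodic: "\<forall>A\<in>sets M. T -` A \<inter> space M = A \<longrightarrow> measure M A = 0 \<or> measure M A = 1"
    and f: "integrable M f"
  shows "AE x in M. (\<lambda>n. birkhoff_sum T f n x / n) \<longlonglongrightarrow> (\<integral>x. f x \<partial>M)"
proof -
  have f': "integrable M (\<lambda>x. - f x)" using f by simp
  show ?thesis
    using AE_birkhoff_average_limsup[OF assms(1) T ergodic f]
      AE_birkhoff_average_limsup[OF assms(1) T ergodic f']
  proof eventually_elim
    case (elim x)
    have neg: "birkhoff_sum T (\<lambda>x. - f x) n x = - birkhoff_sum T f n x" for n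
      by (simp add: birkhoff_sum_def sum_negf)
    show ?case
    proof (rule tendstoI)
      fix e :: real assume "e > 0"
      then obtain k where k: "1 / Suc k < e / 2"
        using nat_approx_posE[of "e / 2"] by (auto simp: field_simps)
      show "\<forall>\<^sub>F n in sequentially. dist (birkhoff_sum T f n x / n) (\<integral>x. f x \<partial>M) < e"
        using elim(1)[rule_format, of k] elim(2)[rule_format, of k]
      proof eventually_elim
        case (elim n)
        then show ?case
          using k by (simp add: dist_real_def neg abs_less_iff)
      qed
    qed
  qed
qed

subsection \<open>Finite bracketing\<close>

text \<open>For \<open>D \<noteq> {}\<close> this is \<open>\<Union>D - \<Inter>D\<close>; the double union makes it measurable for every countable \<open>D\<close>, with no
  special treatment of \<open>\<Inter>{} = UNIV\<close>.\<close>

definition gap :: "'a set set \<Rightarrow> 'a set" where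
  "gap D = (\<Union>C\<in>D. \<Union>C'\<in>D. C - C')"

lemma gap_mono: "D \<subseteq> E \<Longrightarrow> gap D \<subseteq> gap E"
  unfolding gap_def by blast

lemma sets_gap: "countable D \<Longrightarrow> D \<subseteq> sets \<mu> \<Longrightarrow> gap D \<in> sets \<mu>"
  unfolding gap_def by (intro sets.countable_UN' sets.Diff; blast)

text \<open>A nonempty piece \<open>E\<close> lies in the bracket from \<open>\<Inter>E\<close> to
  \<open>\<Union>E\<close>, whose width is the measure of \<open>gap E\<close>. Since the pieces
  consist of members of \<open>D\<close>, the brackets of a countable measurable class have
  measurable ends.\<close>

definition finitely_bracketed :: "'a measure \<Rightarrow> real \<Rightarrow> 'a set set \<Rightarrow> bool" where
  "finitely_bracketed \<mu> \<epsilon> D \<longleftrightarrow>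
     (\<exists>F. finite F \<and> D = \<Union>F \<and> (\<forall>E\<in>F. measure \<mu> (gap E) < \<epsilon>))"

lemma finitely_bracketed_Union:
  assumes "finite F" "\<And>D. D \<in> F \<Longrightarrow> finitely_bracketed \<mu> \<epsilon> D"
  shows "finitely_bracketed \<mu> \<epsilon> (\<Union>F)"
proof -
  obtain G where G: "\<And>D. D \<in> F \<Longrightarrow> finite (G D) \<and> \<Union>(G D) = D \<and> (\<forall>E\<in>G D. measure \<mu> (gap E) < \<epsilon>)"
    using assms(2) unfolding finitely_bracketed_def by metis
  have "\<Union>F = \<Union>(\<Union>(G ` F))"
  proof -
    have "\<Union>(\<Union>(G ` F)) = (\<Union>D\<in>F. \<Union>(G D))" by blast
    also have "\<dots> = (\<Union>D\<in>F. D)" by (intro SUP_cong) (use G in auto)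
    finally show ?thesis by simp
  qed
  moreover have "finite (\<Union>(G ` F))" "\<forall>E\<in>\<Union>(G ` F). measure \<mu> (gap E) < \<epsilon>"
    using assms(1) G by auto
  ultimately show ?thesis
    unfolding finitely_bracketed_def by blast
qed

lemma finitely_bracketed_single: "measure \<mu> (gap D) < \<epsilon> \<Longrightarrow> finitely_bracketed \<mu> \<epsilon> D"
  unfolding finitely_bracketed_def by (intro exI[of _ "{D}"]) auto

text \<open>\<open>E\<close> comes within \<delta> of the infimum over all bad subfamilies of
  \<open>D\<close>; those of \<open>E\<close> are among them.\<close>

lemma gap_nearly_minimal:
  assumes "\<not> finitely_bracketed \<mu> \<epsilon> D" "\<delta> > 0"
  obtains E where "E \<subseteq> D" "\<not> finitely_bracketed \<mu> \<epsilon> E"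
    "\<And>E'. E' \<subseteq> E \<Longrightarrow> \<not> finitely_bracketed \<mu> \<epsilon> E' \<Longrightarrow> measure \<mu> (gap E) - \<delta> < measure \<mu> (gap E')"
proof -
  let ?S = "{E. E \<subseteq> D \<and> \<not> finitely_bracketed \<mu> \<epsilon> E}"
  let ?V = "(\<lambda>E. measure \<mu> (gap E)) ` ?S"
  have ne: "?V \<noteq> {}" using assms by blast
  have bdd: "bdd_below ?V" by (rule bdd_belowI[of _ 0]) auto
  have "Inf ?V < Inf ?V + \<delta>" using assms by simp
  then obtain E where E: "E \<in> ?S" "measure \<mu> (gap E) < Inf ?V + \<delta>"
    using cInf_lessD[OF ne] by blast
  show thesis
  proof (rule that[of E])
    fix E' assume "E' \<subseteq> E" "\<not> finitely_bracketed \<mu> \<epsilon> E'"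
    then have "Inf ?V \<le> measure \<mu> (gap E')"
      using E(1) by (intro cInf_lower[OF _ bdd] imageI) auto
    with E(2) show "measure \<mu> (gap E) - \<delta> < measure \<mu> (gap E')" by simp
  qed (use E in auto)
qed

text \<open>
  A family without finite bracketing contains a decreasing sequence of such subfamilies whose gaps
  are almost as small as possible. On the intersection \<open>W\<close> of these gaps, the members that fail to
  split a given set of positive measure would have a much smaller gap, so most members split it.
\<close>

lemma splitting_region:
  fixes \<mu> :: "'a measure"
  assumes "finite_measure \<mu>" "countable \<C>" "\<C> \<subseteq> sets \<mu>" "\<epsilon> > 0"
    and bad: "\<not> finitely_bracketed \<mu> \<epsilon> \<C>"
  obtains W where "W \<in> sets \<mu>" "measure \<mu> W > 0"
    "\<forall>\<A>. finite \<A> \<longrightarrow> (\<forall>A\<in>\<A>. A \<in> sets \<mu> \<and> A \<subseteq> W \<and> measure \<mu> A > 0) \<longrightarrow>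
       (\<exists>C\<in>\<C>. \<forall>A\<in>\<A>. measure \<mu> (A \<inter> C) > 0 \<and> measure \<mu> (A - C) > 0)"
proof -
  interpret finite_measure \<mu> by fact
  let ?v = "\<lambda>D. measure \<mu> (gap D)"
  define P where "P n D \<longleftrightarrow> D \<subseteq> \<C> \<and> \<not> finitely_bracketed \<mu> \<epsilon> D \<and>
    (\<forall>E. E \<subseteq> D \<longrightarrow> \<not> finitely_bracketed \<mu> \<epsilon> E \<longrightarrow> ?v D - 1 / Suc n < ?v E)" for n D
  have "\<exists>D. \<forall>n. P n (D n) \<and> D (Suc n) \<subseteq> D n"
  proof (rule dependent_nat_choice)
    show "\<exists>D. P 0 D"
      using gap_nearly_minimal[OF bad, of "1 / Suc 0"] unfolding P_def
      by (metis zero_less_one div_by_1 of_nat_1 One_nat_def)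
    fix D n assume D: "P n D"
    then have "\<not> finitely_bracketed \<mu> \<epsilon> D" by (simp add: P_def)
    then obtain E where "E \<subseteq> D" "\<not> finitely_bracketed \<mu> \<epsilon> E"
        "\<And>E'. E' \<subseteq> E \<Longrightarrow> \<not> finitely_bracketed \<mu> \<epsilon> E' \<Longrightarrow> ?v E - 1 / Suc (Suc n) < ?v E'"
      by (rule gap_nearly_minimal[where \<delta>="1 / Suc (Suc n)"]) auto
    with D show "\<exists>E. P (Suc n) E \<and> E \<subseteq> D"
      unfolding P_def by (intro exI[of _ E]) auto
  qed
  then obtain D where P: "\<And>n. P n (D n)" and dec: "\<And>n. D (Suc n) \<subseteq> D n" by blast
  have sub: "D n \<subseteq> \<C>" for n using P by (simp add: P_def)
  have meas: "gap E \<in> sets \<mu>" if "E \<subseteq> \<C>" for E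
    using that assms(2,3) by (intro sets_gap) (auto intro: countable_subset)
  have C: "C \<in> sets \<mu>" if "C \<in> \<C>" for C using that assms by blast
  define W where "W = (\<Inter>n. gap (D n))"
  have W: "W \<in> sets \<mu>"
    unfolding W_def using meas[OF sub] by blast
  have "(\<lambda>n. ?v (D n)) \<longlonglongrightarrow> measure \<mu> W"
    unfolding W_def
    by (rule finite_Lim_measure_decseq)
      (use meas[OF sub] gap_mono[OF dec] in \<open>auto intro!: decseq_SucI\<close>)
  \<comment> \<open>A family with a smaller gap would be its own single bracket.\<close>
  moreover have "?v (D n) \<ge> \<epsilon>" for n
    using P[of n] finitely_bracketed_single[of \<mu> "D n" \<epsilon>] by (force simp: P_def)
  ultimately have "measure \<mu> W \<ge> \<epsilon>"
    by (intro LIMSEQ_le_const) auto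
  with \<open>\<epsilon> > 0\<close> have pos: "measure \<mu> W > 0" by simp
  show thesis
  proof (rule that[OF W pos], intro allI impI)
    fix \<A> assume fin: "finite \<A>"
      and "\<forall>A\<in>\<A>. A \<in> sets \<mu> \<and> A \<subseteq> W \<and> measure \<mu> A > 0"
    then have \<A>: "A \<in> sets \<mu> \<and> A \<subseteq> W \<and> measure \<mu> A > 0" if "A \<in> \<A>" for A
      using that by blast
    \<comment> \<open>The extra 1 keeps \<open>Min\<close> meaningful when there are no sets to
      split.\<close>
    define d where "d = Min (insert 1 (measure \<mu> ` \<A>))"
    have "d > 0" unfolding d_def using fin \<A> by auto
    then obtain n where n: "1 / Suc n < d"
      using nat_approx_posE by blast
    have d: "d \<le> measure \<mu> A" if "A \<in> \<A>" for A
      unfolding d_def using that fin by auto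
    \<comment> \<open>Up to a null set, \<open>A\<close> and \<open>gap E\<close> are disjoint parts
      of \<open>gap (D n)\<close>. So \<open>gap E\<close> is smaller by at least \<open>d\<close>,
      more than the tolerance \<open>1 / Suc n\<close> allows for a bad subfamily.\<close>
    have key: "finitely_bracketed \<mu> \<epsilon> E"
      if A: "A \<in> \<A>" and E: "E \<subseteq> D n" and null: "measure \<mu> (A \<inter> gap E) = 0" for A E
    proof (rule ccontr)
      assume "\<not> finitely_bracketed \<mu> \<epsilon> E"
      then have "?v (D n) - 1 / Suc n < ?v E"
        using P[of n] E by (simp add: P_def)
      moreover have "measure \<mu> A + ?v E = measure \<mu> (A \<union> gap E)"
        using measure_Un3[of A \<mu> "gap E"] \<A>[OF A] meas[of E] E sub[of n] null
        by (simp add: fmeasurable_eq_sets)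
      moreover have "measure \<mu> (A \<union> gap E) \<le> ?v (D n)"
        using \<A>[OF A] gap_mono[OF E] meas[OF sub, of n]
        by (intro finite_measure_mono) (auto simp: W_def)
      ultimately show False
        using n d[OF A] by linarith
    qed
    have null_UN: "measure \<mu> (\<Union>C\<in>E. f C) = 0"
      if "E \<subseteq> \<C>" "\<And>C. C \<in> E \<Longrightarrow> f C \<in> sets \<mu>" "\<And>C. C \<in> E \<Longrightarrow> measure \<mu> (f C) = 0" for E f
    proof -
      have "countable E" using that(1) assms(2) countable_subset by blast
      then have "(\<Union>C\<in>E. f C) \<in> null_sets \<mu>"
        using that(2,3) by (intro null_sets_UN') (auto simp: null_sets_def emeasure_eq_measure)
      then show ?thesis by (simp add: null_sets_def measure_def)
    qed
    \<comment> \<open>A point of \<open>A\<close> in the gap lies in some member of the family, and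
      the countably many traces on \<open>A\<close> are null.\<close>
    have out: "finitely_bracketed \<mu> \<epsilon> {C\<in>D n. measure \<mu> (A \<inter> C) = 0}" (is "finitely_bracketed _ _ ?E")
      if A: "A \<in> \<A>" for A
    proof (rule key[OF A])
      have "measure \<mu> (A \<inter> gap ?E) \<le> measure \<mu> (\<Union>C\<in>?E. A \<inter> C)"
        using \<A>[OF A] C sub[of n] assms(2)
        by (intro finite_measure_mono sets.countable_UN')
          (auto simp: gap_def intro: countable_subset[of _ \<C>])
      also have "\<dots> = 0"
        using \<A>[OF A] C sub[of n] by (intro null_UN) auto
      finally show "measure \<mu> (A \<inter> gap ?E) = 0"
        by (simp add: measure_le_0_iff)
    qed auto
    \<comment> \<open>Dually, a point of \<open>A\<close> in the gap is missed by some
      member.\<close>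
    have ins: "finitely_bracketed \<mu> \<epsilon> {C\<in>D n. measure \<mu> (A - C) = 0}" (is "finitely_bracketed _ _ ?E")
      if A: "A \<in> \<A>" for A
    proof (rule key[OF A])
      have "measure \<mu> (A \<inter> gap ?E) \<le> measure \<mu> (\<Union>C\<in>?E. A - C)"
        using \<A>[OF A] C sub[of n] assms(2)
        by (intro finite_measure_mono sets.countable_UN')
          (auto simp: gap_def intro: countable_subset[of _ \<C>])
      also have "\<dots> = 0"
        using \<A>[OF A] C sub[of n] by (intro null_UN) auto
      finally show "measure \<mu> (A \<inter> gap ?E) = 0"
        by (simp add: measure_le_0_iff)
    qed auto
    show "\<exists>C\<in>\<C>. \<forall>A\<in>\<A>. measure \<mu> (A \<inter> C) > 0 \<and> measure \<mu> (A - C) > 0"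
    proof (rule ccontr)
      assume "\<not> ?thesis"
      then have none: "\<exists>A\<in>\<A>. measure \<mu> (A \<inter> C) = 0 \<or> measure \<mu> (A - C) = 0" if "C \<in> D n" for C
        using that sub[of n] by (metis subsetD measure_nonneg order_le_less)
      let ?F = "(\<lambda>A. {C\<in>D n. measure \<mu> (A \<inter> C) = 0}) ` \<A> \<union> (\<lambda>A. {C\<in>D n. measure \<mu> (A - C) = 0}) ` \<A>"
      have "D n = \<Union>?F"
        using none by auto
      moreover have "finitely_bracketed \<mu> \<epsilon> (\<Union>?F)"
        using fin ins out by (intro finitely_bracketed_Union) auto
      ultimately show False
        using P[of n] by (simp add: P_def)
    qed
  qed
qed

section \<open>Sets in general position and shattering\<close>

lemma full_joins:
  fixes \<mu> :: "'a measure"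
  assumes \<mu>: "finite_measure \<mu>" "countable \<C>" "\<C> \<subseteq> sets \<mu>" "\<epsilon> > 0"
    and bad: "\<not> finitely_bracketed \<mu> \<epsilon> \<C>"
  shows "\<exists>C. (\<forall>i<n::nat. C i \<in> \<C>) \<and> (\<forall>S. \<exists>x. \<forall>i<n. x \<in> C i \<longleftrightarrow> i \<in> S)"
proof -
  interpret finite_measure \<mu> by fact
  obtain W where W: "W \<in> sets \<mu>" "measure \<mu> W > 0"
    and split: "\<forall>\<A>. finite \<A> \<longrightarrow> (\<forall>A\<in>\<A>. A \<in> sets \<mu> \<and> A \<subseteq> W \<and> measure \<mu> A > 0) \<longrightarrow>
       (\<exists>C\<in>\<C>. \<forall>A\<in>\<A>. measure \<mu> (A \<inter> C) > 0 \<and> measure \<mu> (A - C) > 0)"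
    by (rule splitting_region[OF assms])
  define cell where "cell C n S = {x\<in>W. \<forall>i<n. x \<in> C i \<longleftrightarrow> i \<in> S}" for C and n :: nat and S
  \<comment> \<open>Positive measure, not mere nonemptiness, must be carried through the induction,
    because only sets of positive measure can be split again.\<close>
  have "\<exists>C. (\<forall>i<n. C i \<in> \<C>) \<and> (\<forall>S. cell C n S \<in> sets \<mu> \<and> measure \<mu> (cell C n S) > 0)"
  proof (induction n)
    case 0
    then show ?case using W by (auto simp: cell_def)
  next
    case (Suc n)
    then obtain C where C: "\<And>i. i < n \<Longrightarrow> C i \<in> \<C>"
      and cell: "\<And>S. cell C n S \<in> sets \<mu> \<and> measure \<mu> (cell C n S) > 0" by blast
    \<comment> \<open>\<open>S\<close> ranges over all sets of naturals, but only its part below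
      \<open>n\<close> matters. Hence there are finitely many cells, and one member \<open>B\<close>
      splits them all.\<close>
    have "range (cell C n) \<subseteq> cell C n ` Pow {..<n}"
    proof (rule image_subsetI)
      fix S
      have "cell C n S = cell C n (S \<inter> {..<n})" by (auto simp: cell_def)
      then show "cell C n S \<in> cell C n ` Pow {..<n}" by (rule image_eqI) simp
    qed
    then have "finite (range (cell C n))" by (rule finite_subset) simp
    moreover have "\<forall>A\<in>range (cell C n). A \<in> sets \<mu> \<and> A \<subseteq> W \<and> measure \<mu> A > 0"
    proof (rule ballI, erule rangeE)
      fix A S assume "A = cell C n S"
      moreover have "cell C n S \<subseteq> W" unfolding cell_def by blast
      ultimately show "A \<in> sets \<mu> \<and> A \<subseteq> W \<and> measure \<mu> A > 0" using cell[of S] by simp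
    qed
    ultimately have "\<exists>B\<in>\<C>. \<forall>A\<in>range (cell C n). measure \<mu> (A \<inter> B) > 0 \<and> measure \<mu> (A - B) > 0"
      using split by (elim allE impE)
    then obtain B where B: "B \<in> \<C>"
      and BS: "\<And>S. measure \<mu> (cell C n S \<inter> B) > 0 \<and> measure \<mu> (cell C n S - B) > 0"
      by auto
    have cell': "cell (C(n := B)) (Suc n) S = (if n \<in> S then cell C n S \<inter> B else cell C n S - B)" for S
      by (auto simp: cell_def less_Suc_eq)
    have "B \<in> sets \<mu>" using B \<mu> by blast
    show ?case
    proof (intro exI[of _ "C(n := B)"] conjI allI impI)
      fix i assume "i < Suc n"
      then show "(C(n := B)) i \<in> \<C>" using C B by (cases "i = n") auto
    next
      fix S
      show "cell (C(n := B)) (Suc n) S \<in> sets \<mu>"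
        unfolding cell' using cell \<open>B \<in> sets \<mu>\<close> by (auto intro: sets.Int sets.Diff)
      show "measure \<mu> (cell (C(n := B)) (Suc n) S) > 0"
        unfolding cell' using BS by simp
    qed
  qed
  then obtain C where "\<forall>i<n. C i \<in> \<C>" and cell: "\<And>S. measure \<mu> (cell C n S) > 0" by blast
  moreover have "\<exists>x. \<forall>i<n. x \<in> C i \<longleftrightarrow> i \<in> S" for S
  proof -
    have "cell C n S \<noteq> {}" using cell[of S] by (metis measure_empty less_irrefl)
    then show ?thesis unfolding cell_def by blast
  qed
  ultimately show ?thesis by blast
qed

text \<open>
  Indexing \<open>2 ^ k\<close> sets in general position by the subsets \<open>s a\<close> of \<open>{..<k}\<close>, the cell of all sets
  whose index contains \<open>j\<close> yields a point \<open>x j\<close>, and the \<open>k\<close> points so obtained are shattered.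
\<close>

lemma shatters_some_of_full_join:
  assumes C: "\<And>a. a < (2::nat) ^ k \<Longrightarrow> C a \<in> \<C>"
    and join: "\<And>S. \<exists>x. \<forall>a<2 ^ k. x \<in> C a \<longleftrightarrow> a \<in> S"
  shows "shatters_some \<C> k"
proof -
  have "card (Pow {..<k}) = 2 ^ k" by (simp add: card_Pow)
  then obtain s where s: "bij_betw s {..<(2::nat) ^ k} (Pow {..<k})"
    using ex_bij_betw_nat_finite[of "Pow {..<k}"] by (auto simp: atLeast0LessThan)
  have "\<forall>j. \<exists>y. \<forall>a<2 ^ k. y \<in> C a \<longleftrightarrow> j \<in> s a"
    using join[of "{a. j \<in> s a}" for j] by simp
  from choice[OF this] obtain x where x: "\<And>j a. a < 2 ^ k \<Longrightarrow> x j \<in> C a \<longleftrightarrow> j \<in> s a"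
    by blast
  have pick: "\<exists>a<2 ^ k. s a = J" if "J \<subseteq> {..<k}" for J
  proof -
    have "J \<in> s ` {..<2 ^ k}"
      unfolding bij_betw_imp_surj_on[OF s] using that by simp
    then show ?thesis by (metis imageE lessThan_iff)
  qed
  have inj: "inj_on x {..<k}"
  proof (rule inj_onI)
    fix i j assume ij: "i \<in> {..<k}" "j \<in> {..<k}" "x i = x j"
    then have "{i} \<subseteq> {..<k}" by simp
    \<comment> \<open>The set with index \<open>{i}\<close> contains \<open>x i\<close> and none of
      the points \<open>x j\<close> with \<open>j\<close> different from \<open>i\<close>.\<close>
    from pick[OF this] obtain a where a: "a < 2 ^ k" "s a = {i}" by blast
    have "x i \<in> C a" using x[OF a(1)] a(2) by blast
    then have "j \<in> s a" unfolding ij(3) x[OF a(1)] .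
    then show "i = j" using a(2) by simp
  qed
  let ?D = "x ` {..<k}"
  have "{C \<inter> ?D | C. C \<in> \<C>} = Pow ?D"
  proof (intro equalityI subsetI)
    fix Y assume "Y \<in> Pow ?D"
    then obtain J where J: "J \<subseteq> {..<k}" "Y = x ` J" by (auto simp: subset_image_iff)
    then obtain a where a: "a < 2 ^ k" "s a = J" using pick by blast
    have "x j \<in> C a \<longleftrightarrow> j \<in> J" for j
      using x[OF a(1)] a(2) by simp
    then have "Y = C a \<inter> ?D"
      using J by blast
    then show "Y \<in> {C \<inter> ?D | C. C \<in> \<C>}" using C[OF a(1)] by blast
  qed auto
  then show ?thesis
    unfolding shatters_some_def shatter_coeff_def
    by (intro exI[of _ ?D]) (simp add: card_image[OF inj] card_Pow)
qed

text \<open>Otherwise \<open>2 ^ k\<close> members in general position exist for every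
  \<open>k\<close>, and by duality they shatter \<open>k\<close> points.\<close>

lemma vc_finitely_bracketed:
  assumes "finite_measure \<mu>" "countable \<C>" "\<C> \<subseteq> sets \<mu>" "\<epsilon> > 0" "vc_dim \<C> < \<infinity>"
  shows "finitely_bracketed \<mu> \<epsilon> \<C>"
proof (rule ccontr)
  assume "\<not> ?thesis"
  note joins = full_joins[OF assms(1-4) this]
  have "shatters_some \<C> k" for k
  proof -
    obtain C where "\<forall>i<(2::nat) ^ k. C i \<in> \<C>" "\<forall>S. \<exists>x. \<forall>i<2 ^ k. x \<in> C i \<longleftrightarrow> i \<in> S"
      using joins[of "2 ^ k"] by blast
    then show ?thesis
      by (intro shatters_some_of_full_join) auto
  qed
  then show False
    using assms(5) by (simp add: vc_dim_def)
qed

subsection \<open>Uniform convergence\<close>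

lemma shift_funpow: "(shift ^^ i) x 0 = x i"
  by (induction i arbitrary: x) (simp_all add: shift_def funpow_Suc_right del: funpow.simps)

text \<open>Birkhoff's theorem is applied to the shift on path space under the law \<open>P\<close>
  of the process, then pulled back along \<open>path X\<close>.\<close>

lemma ergodic_average_indicator:
  fixes X :: "nat \<Rightarrow> 'w \<Rightarrow> 'a :: topological_space"
  assumes "prob_space M" and X: "stationary_ergodic_process M borel X" and B: "B \<in> sets borel"
  shows "AE \<omega> in M. (\<lambda>n. (1 / real n) * (\<Sum>i<n. indicator B (X i \<omega>)))
           \<longlonglongrightarrow> measure M {\<omega> \<in> space M. X 0 \<omega> \<in> B}"
proof -
  interpret prob_space M by fact
  let ?S = "Pi\<^sub>M UNIV (\<lambda>_. borel) :: (nat \<Rightarrow> 'a) measure"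
  have Xi[measurable]: "X i \<in> measurable M borel" for i
    using X by (simp add: stationary_ergodic_process_def stationary_process_def)
  have path[measurable]: "path X \<in> measurable M ?S"
    by (rule measurable_PiM_single') (auto simp: path_def)
  have shift[measurable]: "shift \<in> measurable ?S ?S"
    by (rule measurable_PiM_single') (auto simp: shift_def)
  define P where "P = distr M ?S (path X)"
  have P: "sets P = sets ?S" "space P = UNIV"
    by (auto simp: P_def space_PiM)
  interpret P: prob_space P
    unfolding P_def by (rule prob_space_distr) (rule path)
  have T: "shift \<in> measurable P P"
    by (simp add: P_def)
  have pres: "distr P P shift = P"
  proof -
    have "distr P P shift = distr P ?S shift"
      by (rule distr_cong) (simp_all add: P)
    also have "\<dots> = distr M ?S (\<lambda>\<omega>. shift (path X \<omega>))"
      unfolding P_def by (subst distr_distr) (simp_all add: comp_def)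
    also have "\<dots> = P"
      using X by (simp add: stationary_ergodic_process_def stationary_process_def P_def)
    finally show ?thesis .
  qed
  \<comment> \<open>Invariant events are by definition preimages of shift-invariant sets of paths,
    so their triviality is ergodicity of \<open>P\<close>.\<close>
  have ergodic: "\<forall>A\<in>sets P. shift -` A \<inter> space P = A \<longrightarrow> measure P A = 0 \<or> measure P A = 1"
  proof (intro ballI impI)
    fix A assume A: "A \<in> sets P" "shift -` A \<inter> space P = A"
    then have "path X -` A \<inter> space M \<in> invariant_events M borel X"
      unfolding invariant_events_def using P by (auto simp: space_PiM)
    then have "measure M (path X -` A \<inter> space M) = 0 \<or> measure M (path X -` A \<inter> space M) = 1"
      using X by (simp add: stationary_ergodic_process_def)
    then show "measure P A = 0 \<or> measure P A = 1"
      using A P unfolding P_def by (simp add: measure_distr)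
  qed
  define f :: "(nat \<Rightarrow> 'a) \<Rightarrow> real" where "f x = indicator B (x 0)" for x
  have fm[measurable]: "f \<in> borel_measurable ?S"
    unfolding f_def[abs_def] using B by measurable
  have "f \<in> borel_measurable P"
    by (simp add: P_def fm)
  then have f: "integrable P f"
    by (intro P.integrable_const_bound[where B=1]) (auto simp: f_def)
  have "(\<integral>x. f x \<partial>P) = (\<integral>\<omega>. indicator {\<omega>\<in>space M. X 0 \<omega> \<in> B} \<omega> \<partial>M)"
    unfolding P_def integral_distr[OF path fm]
    by (rule Bochner_Integration.integral_cong) (auto simp: f_def path_def indicator_def)
  also have "\<dots> = measure M {\<omega>\<in>space M. X 0 \<omega> \<in> B}"
    by (simp add: Int_absorb2)
  finally have int: "(\<integral>x. f x \<partial>P) = measure M {\<omega>\<in>space M. X 0 \<omega> \<in> B}" .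
  have "AE \<omega> in M. (\<lambda>n. birkhoff_sum shift f n (path X \<omega>) / n) \<longlonglongrightarrow> (\<integral>x. f x \<partial>P)"
    using AE_distrD[OF path birkhoff_ergodic[OF P.prob_space_axioms T pres ergodic f, unfolded P_def]]
    by (simp add: P_def)
  then show ?thesis
    unfolding int by (simp add: birkhoff_sum_def f_def shift_funpow path_def)
qed

text \<open>Averages and measures are both monotone, so those of \<open>C\<close> lie between those
  of the bracket ends. The bracket width and the deviation at an end each contribute less than
  \<epsilon>.\<close>

lemma bracket_deviation:
  fixes \<mu> :: "'a measure"
  assumes "finite_measure \<mu>" "countable D" "D \<subseteq> sets \<mu>" "C \<in> D" "measure \<mu> (gap D) < \<epsilon>"
    and lower: "\<bar>(1 / real n) * (\<Sum>i<n. indicator (\<Inter>D) (x i)) - measure \<mu> (\<Inter>D)\<bar> < \<epsilon>"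
    and upper: "\<bar>(1 / real n) * (\<Sum>i<n. indicator (\<Union>D) (x i)) - measure \<mu> (\<Union>D)\<bar> < \<epsilon>"
  shows "\<bar>(1 / real n) * (\<Sum>i<n. indicator C (x i)) - measure \<mu> C\<bar> < 2 * \<epsilon>"
proof -
  interpret finite_measure \<mu> by fact
  let ?A = "\<lambda>B. (1 / real n) * (\<Sum>i<n. indicator B (x i))"
  \<comment> \<open>\<open>D\<close> is nonempty as it contains \<open>C\<close>, so its
    intersection is a countable intersection of measurable sets.\<close>
  have sets: "\<Inter>D \<in> sets \<mu>" "\<Union>D \<in> sets \<mu>" "C \<in> sets \<mu>"
    using assms(2-4) sets.countable_INT'[of D "\<lambda>x. x" \<mu>] by auto
  have mono: "?A E \<le> ?A F" if "E \<subseteq> F" for E F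
    using that by (intro mult_left_mono sum_mono) (auto simp: indicator_def)
  have "gap D = \<Union>D - \<Inter>D"
    by (auto simp: gap_def)
  moreover have "\<Inter>D \<subseteq> \<Union>D"
    using assms(4) by blast
  ultimately have "measure \<mu> (\<Union>D) - measure \<mu> (\<Inter>D) < \<epsilon>"
    using assms(5) sets finite_measure_Diff[of "\<Union>D" "\<Inter>D"] by simp
  moreover have "measure \<mu> (\<Inter>D) \<le> measure \<mu> C" "measure \<mu> C \<le> measure \<mu> (\<Union>D)"
    using assms(4) sets by (auto intro!: finite_measure_mono)
  moreover have "?A (\<Inter>D) \<le> ?A C" "?A C \<le> ?A (\<Union>D)"
    using assms(4) by (intro mono; blast)+
  ultimately show ?thesis
    using lower upper unfolding abs_less_iff by linarith
qed

theorem theorem1: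
  fixes \<C> :: "'a :: polish_space set set"
    and M :: "'w measure"
    and X :: "nat \<Rightarrow> 'w \<Rightarrow> 'a"
  assumes "countable \<C>"
    and "\<C> \<subseteq> sets borel"
    and "vc_dim \<C> < \<infinity>"
    and "prob_space M"
    and "stationary_ergodic_process M borel X"
  shows "AE \<omega> in M. (\<lambda>m. uniform_deviation M X \<C> m \<omega>) \<longlonglongrightarrow> 0"
proof -
  interpret prob_space M by fact
  have X0: "X 0 \<in> measurable M borel"
    using assms(5) by (simp add: stationary_ergodic_process_def stationary_process_def)
  define \<mu> where "\<mu> = distr M borel (X 0)"
  interpret \<mu>: prob_space \<mu>
    unfolding \<mu>_def by (rule prob_space_distr) (rule X0)
  have sets\<mu>: "sets \<mu> = sets borel" by (simp add: \<mu>_def)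
  have \<mu>: "measure M {\<omega> \<in> space M. X 0 \<omega> \<in> B} = measure \<mu> B" if "B \<in> sets borel" for B
    unfolding \<mu>_def using that X0
    by (subst measure_distr) (auto simp: vimage_def Int_def conj_commute)
  define avg :: "'a set \<Rightarrow> nat \<Rightarrow> 'w \<Rightarrow> real"
    where "avg B n \<omega> = (1 / real n) * (\<Sum>i<n. indicator B (X i \<omega>))" for B n \<omega>
  have avg: "AE \<omega> in M. (\<lambda>n. avg B n \<omega>) \<longlonglongrightarrow> measure \<mu> B" if "B \<in> sets borel" for B
    using ergodic_average_indicator[OF assms(4,5) that] by (simp add: avg_def \<mu>[OF that])
  have "AE \<omega> in M. \<forall>k. \<forall>\<^sub>F n in sequentially. \<forall>C\<in>\<C>. \<bar>avg C n \<omega> - measure \<mu> C\<bar> < 2 * (1 / Suc k)"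
  proof (rule AE_all_countable[THEN iffD2, rule_format])
    fix k
    let ?e = "1 / real (Suc k)"
    have "finitely_bracketed \<mu> ?e \<C>"
      using assms by (intro vc_finitely_bracketed) (auto simp: sets\<mu> \<mu>.finite_measure_axioms)
    then obtain F where F: "finite F" "\<C> = \<Union>F" "\<And>D. D \<in> F \<Longrightarrow> measure \<mu> (gap D) < ?e"
      unfolding finitely_bracketed_def by blast
    have D: "countable D" "D \<subseteq> sets borel" if "D \<in> F" for D
    proof -
      have "D \<subseteq> \<C>" using F(2) that by blast
      then show "countable D" "D \<subseteq> sets borel"
        using assms(1,2) countable_subset by blast+
    qed
    have "AE \<omega> in M. (\<lambda>n. avg (\<Inter>D) n \<omega>) \<longlonglongrightarrow> measure \<mu> (\<Inter>D) \<and>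
            (\<lambda>n. avg (\<Union>D) n \<omega>) \<longlonglongrightarrow> measure \<mu> (\<Union>D)" if "D \<in> F" for D
    proof -
      \<comment> \<open>Here \<open>D\<close> may be empty; its intersection is then
        \<open>UNIV\<close>, still a Borel set.\<close>
      have "\<Inter>D \<in> sets borel"
        using D[OF that] sets.countable_INT''[of borel D "\<lambda>x. x"] by auto
      moreover have "\<Union>D \<in> sets borel"
        using D[OF that] by (rule sets.countable_Union)
      ultimately show ?thesis
        using avg by (intro AE_conjI)
    qed
    then have "AE \<omega> in M. \<forall>D\<in>F. (\<lambda>n. avg (\<Inter>D) n \<omega>) \<longlonglongrightarrow> measure \<mu> (\<Inter>D) \<and>
            (\<lambda>n. avg (\<Union>D) n \<omega>) \<longlonglongrightarrow> measure \<mu> (\<Union>D)"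
      using F(1) by (intro AE_finite_allI)
    then show "AE \<omega> in M. \<forall>\<^sub>F n in sequentially. \<forall>C\<in>\<C>. \<bar>avg C n \<omega> - measure \<mu> C\<bar> < 2 * ?e"
    proof eventually_elim
      case (elim \<omega>)
      \<comment> \<open>Finiteness of \<open>F\<close> makes one threshold for \<open>n\<close>
        serve all brackets, which yields uniformity over the class.\<close>
      have "\<forall>\<^sub>F n in sequentially. \<forall>D\<in>F. \<bar>avg (\<Inter>D) n \<omega> - measure \<mu> (\<Inter>D)\<bar> < ?e \<and>
              \<bar>avg (\<Union>D) n \<omega> - measure \<mu> (\<Union>D)\<bar> < ?e"
        using elim by (intro eventually_ball_finite[OF F(1)] ballI eventually_conj)
          (auto dest!: tendstoD[where e="?e"] simp: dist_real_def simp del: of_nat_Suc)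
      then show ?case
      proof eventually_elim
        case (elim n)
        show ?case
        proof
          fix C assume "C \<in> \<C>"
          then obtain D' where D': "D' \<in> F" "C \<in> D'" using F(2) by blast
          then show "\<bar>avg C n \<omega> - measure \<mu> C\<bar> < 2 * ?e"
            unfolding avg_def using elim D[OF D'(1)] F(3)[OF D'(1)]
            by (intro bracket_deviation[OF \<mu>.finite_measure_axioms, of D'])
              (auto simp: sets\<mu> avg_def)
        qed
      qed
    qed
  qed
  then show ?thesis
  proof eventually_elim
    case (elim \<omega>)
    show ?case
    proof (rule order_tendstoI)
      fix a :: ennreal assume "0 < a"
      \<comment> \<open>Bounds on the single terms pass to the supremum only as weak inequalities,
        so room is left below \<open>a\<close>; being below \<open>a\<close> also makes
        \<open>c\<close> finite.\<close>
      then obtain c where c: "0 < c" "c < a" using dense by blast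
      then obtain r where r: "0 \<le> r" "c = ennreal r"
        by (cases c) auto
      with c have "0 < r" by simp
      \<comment> \<open>Half of \<open>r\<close> compensates for the factor 2 in the bracket
        estimate.\<close>
      then obtain k where k: "1 / Suc k < r / 2"
        using nat_approx_posE[of "r / 2"] by auto
      show "\<forall>\<^sub>F n in sequentially. uniform_deviation M X \<C> n \<omega> < a"
        using elim[rule_format, of k]
      proof eventually_elim
        case (elim n)
        have "uniform_deviation M X \<C> n \<omega> \<le> c"
          unfolding uniform_deviation_def
        proof (rule SUP_least)
          fix C assume C: "C \<in> \<C>"
          then have "\<bar>avg C n \<omega> - measure \<mu> C\<bar> \<le> r"
            using elim k by fastforce
          moreover have "C \<in> sets borel" using C assms(2) by blast
          ultimately show "ennreal \<bar>(1 / real n) * (\<Sum>i<n. indicator C (X i \<omega>))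
              - measure M {\<omega> \<in> space M. X 0 \<omega> \<in> C}\<bar> \<le> c"
            by (simp add: r(2) \<mu> avg_def ennreal_leI)
        qed
        with c(2) show ?case by simp
      qed
    qed simp
  qed
qed

end
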